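(* Let $q$ be a prime power and let $\overline{\mathbb{F}_q}$ be an algebraic closure of the finite field $\mathbb{F}_q$. Let $A$ and $B$ be finite-dimensional $\mathbb{F}_q$-subspaces of $\overline{\mathbb{F}_q}$, with $|A|=q^d$. Suppose that $A$ does not contain any nonzero $\mathbb{F}_{q^e}$-subspace of $\overline{\mathbb{F}_q}$ with $e>1$. Then $$|A^{-1}\cap B|\le (d-1)\frac{|B|}{q}+q-d.$$
   Context: For an $\mathbb{F}_q$-subspace $A$ of $\overline{\mathbb{F}_q}$, $A^{-1}=\{x^{-1}: 0\neq x\in A\}$ is the set of inverses of the nonzero elements of $A$. For a positive integer $e$, $\mathbb{F}_{q^e}$ denotes the subfield of $\overline{\mathbb{F}_q}$ with $q^e$ elements.
   Formalization: The subspaces A and B are additionally assumed to be nonzero; with zero subspaces the bound can be negative (e.g. A = {0}, d = 0, |B| = q^3), so the claim fails there. *)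

theory Defs
  imports "HOL-Algebra.Algebraic_Closure" "HOL-Number_Theory.Prime_Powers"
begin

definition inverse_set :: "('a, 'b) ring_scheme \<Rightarrow> 'a set \<Rightarrow> 'a set"
  where "inverse_set L A = {inv\<^bsub>L\<^esub> x | x. x \<in> A \<and> x \<noteq> \<zero>\<^bsub>L\<^esub>}"

(* The library locale "subalgebra F V L" only asks that V be an additive subgroup of L closed
   under multiplication by elements of F.  For a subfield F of L it therefore says that V is an
   F-subspace of L; V need not be closed under multiplication. *)

(* As F ranges over subfields of L with q^e elements, it takes at most one value for each e:
   a field L has at most one subfield of a given finite cardinality. *)
definition no_larger_subspace :: "('a, 'b) ring_scheme \<Rightarrow> nat \<Rightarrow> 'a set \<Rightarrow> bool"
  where "no_larger_subspace L q A \<longleftrightarrow>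
    (\<forall>e F V. e > 1 \<longrightarrow> subfield F L \<longrightarrow> card F = q ^ e \<longrightarrow>
       subalgebra F V L \<longrightarrow> V \<subseteq> A \<longrightarrow> V = {\<zero>\<^bsub>L\<^esub>})"

end

(* Fix y in the intersection of A^-1 and B and cut B into the lines x + Ky, of which there are
   |B|/q.  The line through 0 contains at most q - 1 elements of A^-1, so it is enough that every
   other line contains at most d - 1 of them.  Suppose inv (x + a y) lies in A for d values of a.
   Together with inv y these are d + 1 elements of A, hence dependent over K; so some w = inv (x + a y)
   lies in the span W of inv y and other elements inv (x + b y) of A.  By partial fractions
   y w inv (x + b y) is a multiple of inv (x + b y) - w, so v = y w satisfies v W <= W, while v is
   not in K.  The multipliers of the finite space W thus form a finite field properly containing K,
   over which W is a subspace of A. *)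
theory Submission
  imports Defs
begin

section \<open>Cardinalities of spaces over a finite subfield\<close>

lemma (in ring) dimension_card:
  assumes K: "subfield K R" and "finite K" and "dimension n K E"
  shows "finite E" and "card E = card K ^ n"
proof -
  obtain Us where Us: "set Us \<subseteq> carrier R" "independent K Us" "length Us = n" "Span K Us = E"
    using exists_base[OF K assms(3)] by blast
  define T where "T = {Ks. set Ks \<subseteq> K \<and> length Ks = n}"
  have E: "E = (\<lambda>Ks. combine Ks Us) ` T"
    using Span_eq_combine_set_length_version[OF K Us(1)] Us by (auto simp: T_def)
  have "inj_on (\<lambda>Ks. combine Ks Us) T"
    unfolding inj_on_def
    using unique_decomposition[OF K Us(2)] E Us(3,4) by (auto simp: T_def)
  thus "card E = card K ^ n"
    using card_lists_length_eq[OF \<open>finite K\<close>, of n] by (simp add: E card_image T_def)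
  show "finite E"
    unfolding E using finite_lists_length_eq[OF \<open>finite K\<close>, of n] by (simp add: T_def)
qed

text \<open>The elements of \<open>V\<close> themselves form a finite spanning list. With
  \<open>V\<close> a finite extension field of \<open>K\<close>, this yields the exponent
  \<open>e\<close> that \<open>no_larger_subspace\<close> asks for.\<close>

lemma (in ring) finite_subalgebra_card:
  assumes K: "subfield K R" and "finite K" and V: "subalgebra K V R" "finite V"
  obtains n where "card V = card K ^ n"
proof -
  obtain Us where Us: "set Us = V"
    using \<open>finite V\<close> finite_list by blast
  have V_carr: "V \<subseteq> carrier R"
    using subalgebra_in_carrier[OF V(1)] .
  have "Span K Us = V"
    using subalgebra_Span_incl[OF K V(1), of Us] Span_base_incl[OF K, of Us] Us V_carr by auto
  then obtain n where "dimension n K V"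
    using Span_finite_dimension[OF K, of Us] Us V_carr by (auto simp: finite_dimension_def)
  thus thesis
    using that dimension_card[OF K \<open>finite K\<close>] by blast
qed

lemma (in ring) subalgebraI':
  assumes "subgroup V (add_monoid R)" and "\<And>k v. \<lbrakk> k \<in> K; v \<in> V \<rbrakk> \<Longrightarrow> k \<otimes> v \<in> V"
  shows "subalgebra K V R"
  using assms by (simp add: subalgebra_def subalgebra_axioms_def)

section \<open>The multiplier field of a finite additive subgroup\<close>

definition (in ring) multipliers :: "'a set \<Rightarrow> 'a set"
  where "multipliers W = {z \<in> carrier R. \<forall>w\<in>W. z \<otimes> w \<in> W}"

text \<open>Multiplication by a nonzero multiplier is injective on the finite set \<open>W\<close>,
  hence onto, so division by it preserves \<open>W\<close> as well.\<close>

lemma (in field) multipliers_subfield: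
  assumes W: "subgroup W (add_monoid R)" "finite W"
  shows "subfield (multipliers W) R"
proof (rule subfieldI')
  have W_carr: "w \<in> carrier R" if "w \<in> W" for w
    using subgroup.subset[OF W(1)] that by auto
  have W_add: "v \<oplus> w \<in> W" if "v \<in> W" "w \<in> W" for v w
    using subgroup.m_closed[OF W(1)] that by simp
  have W_minus: "\<ominus> w \<in> W" if "w \<in> W" for w
    using subgroup.m_inv_closed[OF W(1)] that by (simp add: a_inv_def)
  show "subring (multipliers W) R"
    by (rule subringI)
      (auto simp: multipliers_def W_carr W_add W_minus l_minus l_distr m_assoc)
  fix z assume z: "z \<in> multipliers W - {\<zero>}"
  hence zU: "z \<in> Units R"
    by (simp add: multipliers_def field_Units)
  have "inj_on (\<lambda>w. z \<otimes> w) W"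
    using z by (auto simp: inj_on_def multipliers_def W_carr m_lcancel)
  moreover have "(\<lambda>w. z \<otimes> w) ` W \<subseteq> W"
    using z by (auto simp: multipliers_def)
  ultimately have surj: "(\<lambda>w. z \<otimes> w) ` W = W"
    using \<open>finite W\<close> by (simp add: endo_inj_surj)
  have "inv z \<otimes> w \<in> W" if w: "w \<in> W" for w
  proof -
    obtain u where u: "u \<in> W" "w = z \<otimes> u"
      using surj w by blast
    hence "inv z \<otimes> w = u"
      using zU W_carr Units_closed[OF zU] m_assoc[of "inv z" z u] by simp
    thus ?thesis using u by simp
  qed
  thus "inv z \<in> multipliers W"
    using zU by (simp add: multipliers_def)
qed

text \<open>A multiplier is determined by its product with a single nonzero \<open>w\<close>, and
  that product lies in \<open>W\<close>.\<close>

lemma (in field) finite_multipliers: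
  assumes "W \<subseteq> carrier R" "finite W" "w \<in> W" "w \<noteq> \<zero>"
  shows "finite (multipliers W)"
proof (rule inj_on_finite)
  show "inj_on (\<lambda>z. z \<otimes> w) (multipliers W)"
    using assms by (auto simp: inj_on_def multipliers_def m_rcancel)
  show "(\<lambda>z. z \<otimes> w) ` multipliers W \<subseteq> W"
    using assms by (auto simp: multipliers_def)
qed fact

text \<open>The multipliers form a finite field containing \<open>K\<close>, so of cardinality
  \<open>card K ^ e\<close>, and \<open>W\<close> is a nonzero subspace of \<open>A\<close> over
  that field. The assumption on \<open>A\<close> leaves only \<open>e\<close> at most 1.\<close>

lemma (in field) no_larger_subspace_multipliers:
  assumes K: "subfield K R" "finite K" and A: "no_larger_subspace R (card K) A"
    and W: "subalgebra K W R" "finite W" "W \<subseteq> A" "W \<noteq> {\<zero>}"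
  shows "multipliers W = K"
proof -
  let ?F = "multipliers W"
  have W_sub: "subgroup W (add_monoid R)"
    using W(1) by (simp add: subalgebra_def)
  have W_carr: "W \<subseteq> carrier R"
    using subalgebra_in_carrier[OF W(1)] .
  have F: "subfield ?F R"
    using multipliers_subfield[OF W_sub W(2)] .
  have KF: "K \<subseteq> ?F"
    using subalgebra.smult_closed[OF W(1)] subfieldE(3)[OF K(1)] by (auto simp: multipliers_def)
  have "\<zero> \<in> W"
    using subgroup.one_closed[OF W_sub] by simp
  then obtain w where "w \<in> W" "w \<noteq> \<zero>"
    using W(4) by blast
  hence finF: "finite ?F"
    using finite_multipliers W_carr W(2) by blast
  have "subgroup ?F (add_monoid R)"
    using subfieldE(1)[OF F] by (simp add: subring_def)
  hence "subalgebra K ?F R"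
    using KF subringE(6)[OF subfieldE(1)[OF F]] by (intro subalgebraI') auto
  then obtain e where e: "card ?F = card K ^ e"
    using finite_subalgebra_card K finF by blast
  have "subalgebra ?F W R"
    using W_sub by (intro subalgebraI') (auto simp: multipliers_def)
  hence "\<not> e > 1"
    using A e F W(3,4) unfolding no_larger_subspace_def by blast
  \<comment> \<open>Positivity settles the case \<open>e = 0\<close>, where \<open>card ?F\<close>
    would be 1.\<close>
  moreover have "card K > 0"
    using K subringE(4)[OF subfieldE(1)[OF K(1)]] by (simp add: card_gt_0_iff)
  ultimately have "card ?F \<le> card K"
    using e by (cases "e = 0") (auto simp: not_less le_Suc_eq)
  thus ?thesis
    using KF finF card_seteq by blast
qed

text \<open>Multiplication by \<open>v\<close> is \<open>K\<close>-linear, so stability of a span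
  may be tested on its generators.\<close>

lemma (in cring) multipliers_SpanI:
  assumes K: "subfield K R" and Us: "set Us \<subseteq> carrier R" and v: "v \<in> carrier R"
    and mult: "\<And>u. u \<in> set Us \<Longrightarrow> v \<otimes> u \<in> Span K Us"
  shows "v \<in> multipliers (Span K Us)"
proof -
  note K_carr = subfieldE(3)[OF K]
  have "v \<otimes> u \<in> Span K Us" if "u \<in> Span K Us" for u
  proof -
    obtain Ks where Ks: "set Ks \<subseteq> K" "u = combine Ks Us"
      using \<open>u \<in> Span K Us\<close> Span_mem_iff_length_version[OF K Us] by blast
    have "v \<otimes> u = combine Ks Us \<otimes> v"
      using Ks Us K_carr v by (subst m_comm) auto
    also have "\<dots> = combine Ks (map (\<lambda>u. u \<otimes> v) Us)"
      using combine_l_distr Ks Us K_carr v by blast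
    also have "map (\<lambda>u. u \<otimes> v) Us = map (\<lambda>u. v \<otimes> u) Us"
      using Us v m_comm by (intro map_cong) auto
    also have "combine Ks (map (\<lambda>u. v \<otimes> u) Us) \<in> Span K (map (\<lambda>u. v \<otimes> u) Us)"
      using Span_eq_combine_set[OF K, of "map (\<lambda>u. v \<otimes> u) Us"] Ks Us v by auto
    also have "\<dots> \<subseteq> Span K Us"
      by (rule subalgebra_Span_incl[OF K Span_is_subalgebra[OF K Us]]) (use mult in auto)
    finally show ?thesis .
  qed
  thus ?thesis
    using v by (simp add: multipliers_def)
qed

section \<open>Inverses along a line that avoids zero\<close>

lemma (in field) inv_nonzero:
  assumes "x \<in> carrier R" "x \<noteq> \<zero>"
  shows "inv x \<noteq> \<zero>"
  using assms Units_inv_Units[of x] by (simp add: field_Units)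

text \<open>With \<open>s\<close> and \<open>t\<close> the two denominators, 1/t - 1/s = (s - t)/(s
  t), and s - t = (a - b) y.\<close>

lemma (in field) partial_fraction:
  assumes "x \<in> carrier R" "y \<in> carrier R" "a \<in> carrier R" "b \<in> carrier R" "a \<noteq> b"
    and "x \<oplus> a \<otimes> y \<noteq> \<zero>" "x \<oplus> b \<otimes> y \<noteq> \<zero>"
  shows "y \<otimes> inv (x \<oplus> a \<otimes> y) \<otimes> inv (x \<oplus> b \<otimes> y) =
    inv (a \<ominus> b) \<otimes> (inv (x \<oplus> b \<otimes> y) \<ominus> inv (x \<oplus> a \<otimes> y))"
proof -
  define s t c where "s = x \<oplus> a \<otimes> y" and "t = x \<oplus> b \<otimes> y" and "c = a \<ominus> b"
  have U: "s \<in> Units R" "t \<in> Units R" "c \<in> Units R"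
    using assms by (auto simp: s_def t_def c_def field_Units)
  have [simp]: "s \<in> carrier R" "t \<in> carrier R" "c \<in> carrier R"
    using U by auto
  have "s \<ominus> t = c \<otimes> y"
    using assms by (simp add: s_def t_def c_def, algebra)
  have "inv t \<ominus> inv s = (s \<otimes> inv s) \<otimes> inv t \<ominus> (t \<otimes> inv t) \<otimes> inv s"
    using U by simp
  also have "\<dots> = (s \<ominus> t) \<otimes> (inv s \<otimes> inv t)"
    using U Units_inv_closed[OF U(1)] Units_inv_closed[OF U(2)] \<open>s \<in> carrier R\<close> \<open>t \<in> carrier R\<close> by algebra
  also have "\<dots> = c \<otimes> (y \<otimes> inv s \<otimes> inv t)"
    using \<open>s \<ominus> t = c \<otimes> y\<close> U assms(2) by (simp add: m_assoc)
  finally have "inv c \<otimes> (inv t \<ominus> inv s) = (inv c \<otimes> c) \<otimes> (y \<otimes> inv s \<otimes> inv t)"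
    using U assms(2) m_assoc[of "inv c" c "y \<otimes> inv s \<otimes> inv t"] by simp
  thus ?thesis
    using U assms(2) by (simp add: s_def t_def c_def)
qed


lemma (in field) inverse_line_bound:
  assumes K: "subfield K R" "finite K" and A: "subalgebra K A R" "dimension d K A"
    and A': "no_larger_subspace R (card K) A"
    and xy: "x \<in> carrier R" "y \<in> carrier R" "\<And>a. a \<in> K \<Longrightarrow> x \<oplus> a \<otimes> y \<noteq> \<zero>"
    and y: "y \<noteq> \<zero>" "inv y \<in> A"
  shows "card {a \<in> K. inv (x \<oplus> a \<otimes> y) \<in> A} < d"
proof -
  note K_props = subringE[OF subfieldE(1)[OF K(1)]]
  have K_carr: "a \<in> carrier R" if "a \<in> K" for a
    using that K_props(1) by blast
  have finA: "finite A"
    using dimension_card K A(2) by blast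
  define w where "w a = inv (x \<oplus> a \<otimes> y)" for a
  have t_U: "x \<oplus> a \<otimes> y \<in> Units R" if "a \<in> K" for a
    using that xy K_carr by (simp add: field_Units)
  have w_carr: "w a \<in> carrier R" if "a \<in> K" for a
    using t_U[OF that] by (simp add: w_def)
  have y_U: "y \<in> Units R"
    using xy y by (simp add: field_Units)
  obtain as where as: "set as = {a \<in> K. w a \<in> A}" "distinct as"
    using finite_distinct_list[of "{a \<in> K. w a \<in> A}"] K(2) by auto
  \<comment> \<open>The claim is made for all lists so that induction applies. Keeping
    \<open>inv y\<close> at the end makes it the base case, while each new \<open>w a\<close> enters
    at the front.\<close>
  have "independent K (map w as @ [inv y])"
    if "distinct as" "set as \<subseteq> {a \<in> K. w a \<in> A}" for as
    using that
  proof (induction as)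
    case Nil
    show ?case
      using y_U inv_nonzero[OF xy(2) y(1)] by (auto intro!: li_Cons)
  next
    case (Cons a as)
    let ?Us = "map w as @ [inv y]"
    let ?W = "Span K ?Us"
    have a: "a \<in> K" "w a \<in> A" "a \<notin> set as" and as: "set as \<subseteq> K"
      using Cons.prems by auto
    have Us_carr: "set ?Us \<subseteq> carrier R"
      using as w_carr y_U by auto
    have W: "subalgebra K ?W R"
      using Span_is_subalgebra[OF K(1) Us_carr] .
    have Us_W: "set ?Us \<subseteq> ?W"
      using Span_base_incl[OF K(1) Us_carr] .
    have W_A: "?W \<subseteq> A"
      using subalgebra_Span_incl[OF K(1) A(1), of ?Us] Cons.prems y(2) by auto
    have "w a \<notin> ?W"
    proof
      assume wa: "w a \<in> ?W"
      \<comment> \<open>Multiplication by \<open>v\<close> sends \<open>inv y\<close> to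
        \<open>w a\<close>, and \<open>w b\<close> to a \<open>K\<close>-multiple of
        \<open>w b - w a\<close>. Both lie in \<open>?W\<close> because of
        \<open>wa\<close>.\<close>
      define v where "v = y \<otimes> w a"
      have v_carr: "v \<in> carrier R"
        using xy a w_carr by (simp add: v_def)
      have "v \<otimes> u \<in> ?W" if u: "u \<in> set ?Us" for u
      proof (cases "u = inv y")
        case True
        have "v \<otimes> inv y = w a \<otimes> (y \<otimes> inv y)"
          using xy a w_carr y_U Units_inv_closed[OF y_U] w_carr[OF a(1)] unfolding v_def by algebra
        thus ?thesis
          using True y_U w_carr a wa by simp
      next
        case False
        then obtain b where b: "b \<in> set as" "u = w b"
          using u by auto
        hence bK: "b \<in> K" "a \<noteq> b" using as a by auto
        have "v \<otimes> u = inv (a \<ominus> b) \<otimes> (w b \<ominus> w a)"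
          unfolding v_def b w_def using partial_fraction xy a bK K_carr by simp
        moreover have "inv (a \<ominus> b) \<in> K"
        proof -
          have "a \<ominus> b \<in> K - {\<zero>}"
            using a bK K_props(5,7) K_carr r_right_minus_eq by (auto simp: a_minus_def)
          thus ?thesis using subfield_m_inv[OF K(1)] by blast
        qed
        moreover have "w b \<ominus> w a \<in> ?W"
          using Us_W b wa Span_subgroup_props[OF K(1) Us_carr] by (auto simp: a_minus_def)
        ultimately show ?thesis
          using subalgebra.smult_closed[OF W] by simp
      qed
      hence "v \<in> multipliers ?W"
        using multipliers_SpanI[OF K(1) Us_carr v_carr] by blast
      moreover have "multipliers ?W = K"
      proof (rule no_larger_subspace_multipliers[OF K A' W _ W_A])
        show "finite ?W" using finA W_A finite_subset by blast
        have "inv y \<in> ?W" "inv y \<noteq> \<zero>"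
          using Us_W inv_nonzero[OF xy(2) y(1)] by auto
        thus "?W \<noteq> {\<zero>}" by blast
      qed
      ultimately have vK: "v \<in> K" by simp
      \<comment> \<open>If \<open>v\<close> is in \<open>K\<close>, then x + a y = v^-1 y, so the
        point of the line with parameter a - v^-1 is zero, which is excluded.\<close>
      have y_eq: "y = v \<otimes> (x \<oplus> a \<otimes> y)"
        using t_U[OF a(1)] xy a K_carr by (simp add: v_def w_def m_assoc)
      have "v \<noteq> \<zero>"
        using y_eq y t_U[OF a(1)] by auto
      hence iv: "inv v \<in> K" "v \<in> Units R"
        using subfield_m_inv[OF K(1)] vK v_carr by (auto simp: field_Units)
      have "inv v \<otimes> y = x \<oplus> a \<otimes> y"
        using y_eq iv v_carr m_assoc[of "inv v" v "x \<oplus> a \<otimes> y"] xy a K_carr by simp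
      hence "x \<oplus> (a \<ominus> inv v) \<otimes> y = \<zero>"
        using xy K_carr[OF a(1)] K_carr[OF iv(1)] by algebra
      moreover have "a \<ominus> inv v \<in> K"
        using a iv K_props(5,7) by (simp add: a_minus_def)
      ultimately show False
        using xy(3) by blast
    qed
    thus ?case
      using Cons a w_carr by (auto intro!: li_Cons)
  qed
  hence "independent K (map w as @ [inv y])"
    using as by blast
  \<comment> \<open>The extra vector \<open>inv y\<close> is what makes the final bound
    strict.\<close>
  hence "length (map w as @ [inv y]) \<le> d"
    by (rule independent_length_le_dimension[OF K(1) A(2)]) (use as(1) y(2) in auto)
  thus ?thesis
    using as distinct_card[of as] by (simp add: w_def)
qed


section \<open>Counting by parallel lines\<close>

text \<open>The cosets of \<open>K y\<close> partition \<open>B\<close>. The one through zero meets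
  \<open>N\<close> in fewer than \<open>card K\<close> points, each other one in at most
  \<open>m\<close>. Writing \<open>+ m\<close> on the left avoids truncated subtraction.\<close>

lemma (in field) card_le_by_lines:
  assumes K: "subfield K R" "finite K" and B: "subalgebra K B R" "finite B"
    and y: "y \<in> B" "y \<noteq> \<zero>" and N: "N \<subseteq> B" "\<zero> \<notin> N"
    and line: "\<And>x. \<lbrakk> x \<in> B; \<And>a. a \<in> K \<Longrightarrow> x \<oplus> a \<otimes> y \<noteq> \<zero> \<rbrakk> \<Longrightarrow>
      card {a \<in> K. x \<oplus> a \<otimes> y \<in> N} \<le> m"
  shows "card N + m < card K + m * (card B div card K)" and "card K dvd card B"
proof -
  note K_props = subringE[OF subfieldE(1)[OF K(1)]]
  have K_carr: "a \<in> carrier R" if "a \<in> K" for a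
    using that K_props(1) by blast
  have B_carr: "b \<in> carrier R" if "b \<in> B" for b
    using that subalgebra_in_carrier[OF B(1)] by blast
  have y_carr: "y \<in> carrier R"
    using B_carr y by blast
  have B_sub: "subgroup B (add_monoid R)"
    using B(1) by (simp add: subalgebra_def)
  have Bz: "\<zero> \<in> B"
    using subgroup.one_closed[OF B_sub] by simp
  have B_line: "x \<oplus> a \<otimes> y \<in> B" if "x \<in> B" "a \<in> K" for x a
    using that subgroup.m_closed[OF B_sub] subalgebra.smult_closed[OF B(1)] y by simp
  define C where "C x = (\<lambda>a. x \<oplus> a \<otimes> y) ` K" for x
  have inj: "inj_on (\<lambda>a. x \<oplus> a \<otimes> y) K" if "x \<in> B" for x
    using that y y_carr B_carr K_carr by (auto simp: inj_on_def m_rcancel)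
  have self: "x \<in> C x" if "x \<in> B" for x
    using that B_carr y_carr K_props(2) unfolding C_def by (intro image_eqI[of _ _ \<zero>]) auto
  have sub: "C (x \<oplus> a \<otimes> y) = C x" if x: "x \<in> B" "a \<in> K" for x a
  proof -
    \<comment> \<open>One inclusion suffices: applied at the base point x + a y with parameter -a,
      it gives the reverse one.\<close>
    have *: "C (x \<oplus> a \<otimes> y) \<subseteq> C x" if "x \<in> B" "a \<in> K" for x a
    proof
      fix z assume "z \<in> C (x \<oplus> a \<otimes> y)"
      then obtain b where b: "b \<in> K" "z = x \<oplus> a \<otimes> y \<oplus> b \<otimes> y"
        by (auto simp: C_def)
      hence "z = x \<oplus> (a \<oplus> b) \<otimes> y"
        using that B_carr K_carr y_carr by (simp add: l_distr a_assoc)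
      thus "z \<in> C x"
        using b that K_props(7) by (auto simp: C_def)
    qed
    have "x = x \<oplus> a \<otimes> y \<oplus> (\<ominus> a) \<otimes> y"
      using x B_carr[OF x(1)] K_carr[OF x(2)] y_carr by algebra
    hence "C x \<subseteq> C (x \<oplus> a \<otimes> y)"
      using *[OF B_line[OF x], of "\<ominus> a"] x K_props(5) by simp
    thus ?thesis
      using *[OF x] by blast
  qed
  have C_eq: "C z = C x" if "x \<in> B" "z \<in> C x" for x z
  proof -
    obtain a where "a \<in> K" "z = x \<oplus> a \<otimes> y"
      using \<open>z \<in> C x\<close> by (auto simp: C_def)
    thus ?thesis
      using sub \<open>x \<in> B\<close> by blast
  qed
  have C_sub: "C x \<subseteq> B" if "x \<in> B" for x
    using that B_line by (auto simp: C_def)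
  let ?L = "C ` B"
  have Un: "\<Union> ?L = B"
    using self C_sub by blast
  have finL: "finite ?L"
    using B(2) by simp
  have part: "card K * card ?L = card B"
  proof -
    have "card K * card ?L = card (\<Union> ?L)"
    proof (rule card_partition)
      show "card c = card K" if "c \<in> ?L" for c
        using that inj by (auto simp: C_def card_image)
      show "c1 \<inter> c2 = {}" if "c1 \<in> ?L" "c2 \<in> ?L" "c1 \<noteq> c2" for c1 c2
        using that C_eq by blast
    qed (use finL Un B(2) in auto)
    thus ?thesis using Un by simp
  qed
  thus "card K dvd card B"
    by (metis dvd_triv_left)
  have Kpos: "card K > 0"
    using K(2) K_props(4) by (simp add: card_gt_0_iff)
  have cardL: "card ?L = card B div card K"
    using part Kpos by (metis nonzero_mult_div_cancel_left less_numeral_extra(3))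
  have C0: "C \<zero> \<in> ?L"
    using Bz by blast
  have card_NC: "card (N \<inter> C x) = card {a \<in> K. x \<oplus> a \<otimes> y \<in> N}" if x: "x \<in> B" for x
  proof -
    have "N \<inter> C x = (\<lambda>a. x \<oplus> a \<otimes> y) ` {a \<in> K. x \<oplus> a \<otimes> y \<in> N}"
      by (auto simp: C_def)
    thus ?thesis
      using inj_on_subset[OF inj[OF x]] by (simp add: card_image)
  qed
  have other: "card (N \<inter> c) \<le> m" if c: "c \<in> ?L - {C \<zero>}" for c
  proof -
    obtain x where x: "x \<in> B" "c = C x"
      using c by blast
    have "C x \<noteq> C \<zero>"
      using c x(2) by simp
    \<comment> \<open>A line passing through zero coincides with \<open>C \<zero>\<close>, by
      \<open>sub\<close>.\<close>
    hence "x \<oplus> a \<otimes> y \<noteq> \<zero>" if "a \<in> K" for a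
      using sub[OF x(1) that] by metis
    thus ?thesis
      using line x card_NC by simp
  qed
  have "N \<inter> C \<zero> \<subseteq> C \<zero> - {\<zero>}"
    using N(2) by blast
  hence "card (N \<inter> C \<zero>) \<le> card (C \<zero> - {\<zero>})"
    using K(2) by (intro card_mono) (auto simp: C_def)
  also have "\<dots> < card (C \<zero>)"
    using self[OF Bz] K(2) by (intro psubset_card_mono) (auto simp: C_def)
  also have "\<dots> = card K"
    using inj[OF Bz] by (simp add: C_def card_image)
  finally have zero: "card (N \<inter> C \<zero>) < card K" .
  have "N = (\<Union>c\<in>?L. N \<inter> c)"
    using Un N(1) by blast
  hence "card N \<le> (\<Sum>c\<in>?L. card (N \<inter> c))"
    using card_UN_le[OF finL, of "\<lambda>c. N \<inter> c"] by simp
  also have "\<dots> = card (N \<inter> C \<zero>) + (\<Sum>c\<in>?L - {C \<zero>}. card (N \<inter> c))"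
    using sum.remove[OF finL C0] by simp
  also have "(\<Sum>c\<in>?L - {C \<zero>}. card (N \<inter> c)) \<le> card (?L - {C \<zero>}) * m"
    using sum_bounded_above[of "?L - {C \<zero>}" "\<lambda>c. card (N \<inter> c)" m] other by simp
  also have "card (?L - {C \<zero>}) = card ?L - 1"
    using C0 finL by simp
  finally have "card N \<le> card (N \<inter> C \<zero>) + (card ?L - 1) * m"
    by simp
  \<comment> \<open>The subtraction is not truncated, since \<open>C \<zero>\<close> belongs to
    \<open>?L\<close>.\<close>
  moreover have "(card ?L - 1) * m + m = m * card ?L"
    using C0 finL by (cases "card ?L") (auto simp: card_gt_0_iff)
  ultimately show "card N + m < card K + m * (card B div card K)"
    using zero unfolding cardL by linarith
qed

text \<open>Requiring \<open>A\<close> and \<open>B\<close> to be nonzero excludes degenerate cases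
  in which the right-hand side can be negative: for A = {0} it is q - |B|/q, negative once |B| >
  q^2; for B = {0} it is (q - 1)(1 - (d - 1)/q), negative once d > q + 1.\<close>

theorem mainTheorem3:
  fixes L :: "('a, 'b) ring_scheme" and K A B :: "'a set" and q d :: nat
  assumes "primepow q"
    and "algebraic_closure L K" and "card K = q"
    and "subalgebra K A L" and "ring.finite_dimension L K A"
    and "subalgebra K B L" and "ring.finite_dimension L K B"
    and "A \<noteq> {\<zero>\<^bsub>L\<^esub>}" and "B \<noteq> {\<zero>\<^bsub>L\<^esub>}"
    and "card A = q ^ d"
    and "no_larger_subspace L q A"
  shows "real (card (inverse_set L A \<inter> B))
    \<le> (real d - 1) * (real (card B) / real q) + real q - real d"
proof -
  interpret field L
    using assms(2) by (simp add: algebraic_closure_def)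
  have K: "subfield K L"
    using assms(2) by (simp add: algebraic_closure_def)
  have q: "q > 1"
    using assms(1) by (rule primepow_gt_Suc_0[unfolded One_nat_def[symmetric]])
  hence finK: "finite K"
    using assms(3) by (intro card_ge_0_finite) simp
  obtain n where n: "dimension n K A"
    using assms(5) by (auto simp: finite_dimension_def)
  have "n = d"
    using dimension_card(2)[OF K finK n] assms(3,10) q by simp
  hence d: "dimension d K A"
    using n by simp
  \<comment> \<open>Positivity makes the natural number \<open>d - 1\<close> agree with
    \<open>real d - 1\<close>.\<close>
  have d0: "d > 0"
    using d dimension_zero[OF K, of A] assms(8) by (cases d) auto
  have finB: "finite B"
    using assms(7) dimension_card(1)[OF K finK] by (auto simp: finite_dimension_def)
  have A_carr: "A \<subseteq> carrier L"
    using subalgebra_in_carrier[OF assms(4)] .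
  have B_carr: "B \<subseteq> carrier L"
    using subalgebra_in_carrier[OF assms(6)] .
  let ?N = "inverse_set L A \<inter> B"
  have N: "inv\<^bsub>L\<^esub> u \<in> A" "u \<noteq> \<zero>\<^bsub>L\<^esub>" if "u \<in> ?N" for u
    using that A_carr inv_nonzero by (auto simp: inverse_set_def field_Units Units_inv_inv)
  \<comment> \<open>The condition on \<open>inv y\<close> is conditional so that an empty
    \<open>?N\<close> is covered too: any nonzero direction \<open>y\<close> in \<open>B\<close>
    then works, as every line count is 0.\<close>
  have bound: "card ?N + (d - 1) < q + (d - 1) * (card B div q) \<and> q dvd card B"
    if y: "y \<in> B" "y \<noteq> \<zero>\<^bsub>L\<^esub>" and yN: "?N \<noteq> {} \<Longrightarrow> inv\<^bsub>L\<^esub> y \<in> A" for y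
  proof -
    have "card {a \<in> K. x \<oplus>\<^bsub>L\<^esub> a \<otimes>\<^bsub>L\<^esub> y \<in> ?N} \<le> d - 1"
      if x: "x \<in> B" "\<And>a. a \<in> K \<Longrightarrow> x \<oplus>\<^bsub>L\<^esub> a \<otimes>\<^bsub>L\<^esub> y \<noteq> \<zero>\<^bsub>L\<^esub>" for x
    proof (cases "?N = {}")
      case False
      have "card {a \<in> K. x \<oplus>\<^bsub>L\<^esub> a \<otimes>\<^bsub>L\<^esub> y \<in> ?N}
          \<le> card {a \<in> K. inv\<^bsub>L\<^esub> (x \<oplus>\<^bsub>L\<^esub> a \<otimes>\<^bsub>L\<^esub> y) \<in> A}"
        using N finK by (intro card_mono) auto
      also have "\<dots> < d"
        using inverse_line_bound[OF K finK assms(4) d] assms(3,11) x y yN False B_carr by blast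
      finally show ?thesis by simp
    qed (simp only: empty_iff, simp)
    thus ?thesis
      using card_le_by_lines[OF K finK assms(6) finB y, of ?N "d - 1"] N(2) assms(3) by blast
  qed
  obtain y where "y \<in> B" "y \<noteq> \<zero>\<^bsub>L\<^esub>" "?N \<noteq> {} \<Longrightarrow> inv\<^bsub>L\<^esub> y \<in> A"
  proof (cases "?N = {}")
    case True
    have "\<zero>\<^bsub>L\<^esub> \<in> B"
      using subgroup.one_closed[of B "add_monoid L"] assms(6) by (simp add: subalgebra_def)
    thus ?thesis
      using that True assms(9) by blast
  next
    case False
    thus ?thesis
      using that N by blast
  qed
  hence *: "card ?N + (d - 1) < q + (d - 1) * (card B div q)" "q dvd card B"
    using bound by blast+
  \<comment> \<open>The strict inequality absorbs the 1 by which \<open>d\<close> exceeds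
    \<open>d - 1\<close>. Divisibility of \<open>card B\<close> by \<open>q\<close> then turns
    \<open>div\<close> into the real quotient.\<close>
  have "real (card ?N + d) \<le> real (q + (d - 1) * (card B div q))"
    unfolding of_nat_le_iff using *(1) d0 by linarith
  thus ?thesis
    using *(2) d0 by (simp add: real_of_nat_div of_nat_diff)
qed

end
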